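(* For integers $m\ge n\ge 1$ let $\beta(m,n)$ denote the supremum of the Braess Ratio $BR$ over all demands $q>0$, all coefficients $a>0$, $b,c,d\ge0$, and all chords $u\to v$, for the directed grid $G_{m,n}$ with source $(0,0)$, sink $(m,n)$, latency $ax+b$ on every grid edge and latency $cx+d$ on the chord. Then there is a function $g:(0,1]\to\mathbb R$ with $g(r)=O(r^3)$ as $r\to0^+$ such that for every rational aspect ratio $r=n/m\in(0,1]$, \[ \limsup_{\substack{m\to\infty\\ rm\in\mathbb Z}}\ \beta(m,rm)\ \le\ \frac43-\frac29\,r+\frac{19}{108}\,r^2+g(r). \]
   Context: Grid: $G_{m,n}=(V,E)$ is the directed graph with vertex set $V=\{0,\dots,m\}\times\{0,\dots,n\}$ and directed edges $(i,j)\to(i+1,j)$ for $i<m$ and $(i,j)\to(i,j+1)$ for $j<n$; $s=(0,0)$, $t=(m,n)$. Chord: an added directed edge $u\to v$ with $u,v\in V$, $u\ne v$, such that $uv$ is not an edge of the underlying undirected grid. Feasible flow (in the grid, or in the grid plus chord): a nonnegative number $f_e$ for each directed edge $e$, with flow conserved at every vertex other than $s,t$, and net outflow from $s$ and net inflow to $t$ both equal to $q$. Its cost is $C(f)=\sum_e f_e\ell_e(f_e)$, where $\ell_e$ is the latency function of $e$. User Equilibrium: a feasible flow, decomposable into flows along $s$-$t$ paths, such that every path carrying positive flow has latency (sum of $\ell_e(f_e)$ over its edges) no larger than that of any other $s$-$t$ path. By a classical theorem (Beckmann, McGuire, Winsten) these are exactly the minimizers over feasible flows of the Beckmann potential $Z(f)=\sum_e\int_0^{f_e}\ell_e(y)\,dy$;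 in the networks considered here the minimizer is unique. Braess Ratio: $BR=C_{\mathrm{new}}/C_{\mathrm{old}}$, where $C_{\mathrm{old}}$ is the cost of the User Equilibrium of $G_{m,n}$ and $C_{\mathrm{new}}$ is the cost of the User Equilibrium of $G_{m,n}$ with the chord added (same $s,t,q$). *)

theory Defs
  imports
    "HOL-Analysis.Analysis"
    "HOL-Library.Landau_Symbols"
    "Graph_Theory.Arc_Walk"
begin

type_synonym vertex = "nat \<times> nat"
type_synonym arc = "vertex \<times> vertex"

definition grid :: "nat \<Rightarrow> nat \<Rightarrow> (vertex, arc) pre_digraph" where
  "grid m n =
    \<lparr> verts = {0..m} \<times> {0..n},
      arcs = {((i, j), (i + 1, j)) | i j. i < m \<and> j \<le> n} \<union>
             {((i, j), (i, j + 1)) | i j. i \<le> m \<and> j < n},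
      tail = fst, head = snd \<rparr>"

definition is_chord :: "nat \<Rightarrow> nat \<Rightarrow> arc \<Rightarrow> bool" where
  "is_chord m n e \<longleftrightarrow>
     fst e \<in> verts (grid m n) \<and> snd e \<in> verts (grid m n) \<and> fst e \<noteq> snd e \<and>
     (fst e, snd e) \<notin> arcs (grid m n) \<and> (snd e, fst e) \<notin> arcs (grid m n)"

text \<open>Flows and latencies are functions on the whole arc type; only their values on the
  arcs of the graph matter.\<close>

definition net_outflow :: "('a, 'e) pre_digraph \<Rightarrow> ('e \<Rightarrow> real) \<Rightarrow> 'a \<Rightarrow> real" where
  "net_outflow G f v = (\<Sum>e \<in> out_arcs G v. f e) - (\<Sum>e \<in> in_arcs G v. f e)"

definition feasible_flow ::
  "('a, 'e) pre_digraph \<Rightarrow> 'a \<Rightarrow> 'a \<Rightarrow> real \<Rightarrow> ('e \<Rightarrow> real) \<Rightarrow> bool" where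
  "feasible_flow G s t q f \<longleftrightarrow>
     (\<forall>e \<in> arcs G. 0 \<le> f e) \<and>
     (\<forall>v \<in> verts G - {s, t}. net_outflow G f v = 0) \<and>
     net_outflow G f s = q \<and> - net_outflow G f t = q"

definition flow_cost :: "('a, 'e) pre_digraph \<Rightarrow> ('e \<Rightarrow> real \<Rightarrow> real) \<Rightarrow> ('e \<Rightarrow> real) \<Rightarrow> real" where
  "flow_cost G lat f = (\<Sum>e \<in> arcs G. f e * lat e (f e))"

definition path_latency :: "('e \<Rightarrow> real \<Rightarrow> real) \<Rightarrow> ('e \<Rightarrow> real) \<Rightarrow> 'e list \<Rightarrow> real" where
  "path_latency lat f p = (\<Sum>e \<leftarrow> p. lat e (f e))"

text \<open>The function \<open>h\<close> assigns to each directed simple path from \<open>s\<close> to \<open>t\<close> (given as a list of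
  arcs) the amount of flow it carries in a decomposition of \<open>f\<close>.\<close>

definition user_equilibrium ::
  "('a, 'e) pre_digraph \<Rightarrow> 'a \<Rightarrow> 'a \<Rightarrow> real \<Rightarrow> ('e \<Rightarrow> real \<Rightarrow> real) \<Rightarrow> ('e \<Rightarrow> real) \<Rightarrow> bool" where
  "user_equilibrium G s t q lat f \<longleftrightarrow>
     feasible_flow G s t q f \<and>
     (\<exists>h :: 'e list \<Rightarrow> real.
        (\<forall>p. pre_digraph.apath G s p t \<longrightarrow> 0 \<le> h p) \<and>
        (\<forall>e \<in> arcs G. f e = (\<Sum>p | pre_digraph.apath G s p t \<and> e \<in> set p. h p)) \<and>
        (\<forall>p p'. pre_digraph.apath G s p t \<and> 0 < h p \<and> pre_digraph.apath G s p' t \<longrightarrow>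
           path_latency lat f p \<le> path_latency lat f p'))"

text \<open>In the networks below the equilibrium is unique on the arcs of the graph, but not as a
  function on the whole arc type; hence the description operator is applied to the cost.\<close>

definition ue_cost ::
  "('a, 'e) pre_digraph \<Rightarrow> 'a \<Rightarrow> 'a \<Rightarrow> real \<Rightarrow> ('e \<Rightarrow> real \<Rightarrow> real) \<Rightarrow> real" where
  "ue_cost G s t q lat = (THE C. \<exists>f. user_equilibrium G s t q lat f \<and> C = flow_cost G lat f)"

definition braess_ratio ::
  "nat \<Rightarrow> nat \<Rightarrow> real \<Rightarrow> real \<Rightarrow> real \<Rightarrow> real \<Rightarrow> real \<Rightarrow> arc \<Rightarrow> real" where
  "braess_ratio m n q a b c d ch =
     ue_cost (pre_digraph.add_arc (grid m n) ch) (0, 0) (m, n) q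
       (\<lambda>e x. if e = ch then c * x + d else a * x + b) /
     ue_cost (grid m n) (0, 0) (m, n) q (\<lambda>e x. a * x + b)"

text \<open>The supremum is taken in the extended reals, so that no finiteness is presupposed.\<close>

definition braess_sup :: "nat \<Rightarrow> nat \<Rightarrow> ereal" where
  "braess_sup m n =
     Sup {ereal (braess_ratio m n q a b c d ch) | q a b c d ch.
            0 < q \<and> 0 < a \<and> 0 \<le> b \<and> 0 \<le> c \<and> 0 \<le> d \<and> is_chord m n ch}"

end

theory Submission
  imports Defs "HOL-Real_Asymp.Real_Asymp"
begin

text \<open>Write \<open>N = m + n\<close> for the common length of all grid paths. The discrete Dirichlet
  problem on the faces of the grid has a solution monotone in both coordinates; its discrete
  derivative is the undirected electrical \<open>s\<close>-\<open>t\<close> flow, which therefore respects all arc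
  directions, and \<open>q\<close> times it is the equilibrium \<open>f0\<close> of the grid. In particular \<open>f0\<close> is the
  gradient of a potential.

  Let \<open>f\<close> be the new equilibrium, \<open>x \<le> q\<close> its chord flow, \<open>h\<close> the difference of the levels
  \<open>i + j\<close> of the two ends of the chord, and let \<open>S\<close>, \<open>P\<close>, \<open>F\<close> denote \<open>a\<close> times the grid inner
  products \<open>(f0, f0)\<close>, \<open>(f, f0)\<close>, \<open>(f, f)\<close>. The variational inequality of \<open>f\<close>
  against \<open>f0\<close> gives \<open>C_new \<le> P + b N q\<close>, whereas \<open>C_old = S + b N q\<close> and
  \<open>C_new \<ge> F + b (N q - h x)\<close>. A paradox needs \<open>P > S\<close>. Then the potential of \<open>f0\<close> moves against
  the chord, so the chord is not monotone in both coordinates and \<open>h \<le> m\<close>; hence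
  \<open>b N q \<ge> k (F - P)\<close> with \<open>k = N / m = 1 + r\<close>. Together with \<open>P\<^sup>2 \<le> F S\<close> and the inequality of
  arithmetic and geometric means this yields \<open>BR \<le> 1 + 1 / (k + 2 sqrt k)\<close>, whose second
  order expansion at \<open>r = 0\<close> is the asserted bound.\<close>

section \<open>Path flows and user equilibria\<close>

text \<open>This is the decomposition inside \<open>user_equilibrium\<close> without its latency
  condition. Fixing the total path flow to \<open>q\<close> takes the place of conservation at the
  vertices, which then follows.\<close>

definition path_flow ::
  "('a, 'e) pre_digraph \<Rightarrow> 'a \<Rightarrow> 'a \<Rightarrow> real \<Rightarrow> ('e list \<Rightarrow> real) \<Rightarrow> ('e \<Rightarrow> real) \<Rightarrow> bool" where
  "path_flow G s t q h f \<longleftrightarrow>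
     (\<forall>p. pre_digraph.apath G s p t \<longrightarrow> 0 \<le> h p) \<and>
     (\<Sum>p | pre_digraph.apath G s p t. h p) = q \<and>
     (\<forall>e \<in> arcs G. f e = (\<Sum>p | pre_digraph.apath G s p t \<and> e \<in> set p. h p))"

lemma (in wf_digraph) awalk_sum_potential:
  fixes \<phi> :: "'a \<Rightarrow> real"
  assumes "awalk u p v"
  shows "(\<Sum>e\<leftarrow>p. \<phi> (head G e) - \<phi> (tail G e)) = \<phi> v - \<phi> u"
  using assms by (induction p arbitrary: u) (auto simp: awalk_simps)

lemma (in wf_digraph) apath_distinct: "apath u p v \<Longrightarrow> distinct p"
  unfolding apath_def using distinct_verts_imp_distinct by blast

lemma (in wf_digraph) apath_arcs: "apath u p v \<Longrightarrow> set p \<subseteq> arcs G"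
  unfolding apath_def awalk_def by blast

context fin_digraph
begin

text \<open>Interchange the sums over arcs and over paths. A simple path repeats no arc, so summing
  over its set of arcs agrees with summing along its list.\<close>

lemma path_flow_pairing:
  assumes "path_flow G s t q h f"
  shows "(\<Sum>e\<in>arcs G. g e * f e) = (\<Sum>p | apath s p t. h p * (\<Sum>e\<leftarrow>p. g e))"
proof -
  have "(\<Sum>e\<in>arcs G. g e * f e)
      = (\<Sum>e\<in>arcs G. \<Sum>p | apath s p t. if e \<in> set p then g e * h p else 0)"
  proof (rule sum.cong[OF refl])
    fix e assume "e \<in> arcs G"
    then have "f e = (\<Sum>p | apath s p t \<and> e \<in> set p. h p)"
      using assms unfolding path_flow_def by blast
    also have "\<dots> = (\<Sum>p | apath s p t. if e \<in> set p then h p else 0)"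
      by (simp add: apaths_finite sum.inter_filter[symmetric])
    finally show "g e * f e = (\<Sum>p | apath s p t. if e \<in> set p then g e * h p else 0)"
      by (simp add: sum_distrib_left if_distrib cong: if_cong)
  qed
  also have "\<dots> = (\<Sum>p | apath s p t. \<Sum>e\<in>arcs G. if e \<in> set p then g e * h p else 0)"
    by (rule sum.swap)
  also have "\<dots> = (\<Sum>p | apath s p t. h p * (\<Sum>e\<leftarrow>p. g e))"
  proof (rule sum.cong[OF refl])
    fix p assume "p \<in> {p. apath s p t}"
    then have p: "distinct p" "set p \<subseteq> arcs G"
      using apath_distinct apath_arcs by auto
    have "(\<Sum>e\<in>arcs G. if e \<in> set p then g e * h p else 0) = (\<Sum>e\<in>set p. g e * h p)"
      using p(2) by (intro sum.mono_neutral_cong_right) auto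
    also have "\<dots> = h p * (\<Sum>e\<in>set p. g e)"
      by (simp add: sum_distrib_left mult.commute)
    also have "(\<Sum>e\<in>set p. g e) = (\<Sum>e\<leftarrow>p. g e)"
      using p(1) by (rule sum.distinct_set_conv_list)
    finally show "(\<Sum>e\<in>arcs G. if e \<in> set p then g e * h p else 0) = h p * (\<Sum>e\<leftarrow>p. g e)" .
  qed
  finally show ?thesis .
qed

text \<open>The sum telescopes along each path. With levels, vertex indicators or the electrical
  potential as \<open>\<phi>\<close>, this serves wherever conservation is needed.\<close>

lemma path_flow_potential:
  assumes "path_flow G s t q h f"
  shows "(\<Sum>e\<in>arcs G. (\<phi> (head G e) - \<phi> (tail G e)) * f e) = q * (\<phi> t - \<phi> s)"
proof -
  have "(\<Sum>e\<in>arcs G. (\<phi> (head G e) - \<phi> (tail G e)) * f e)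
      = (\<Sum>p | apath s p t. h p * (\<Sum>e\<leftarrow>p. \<phi> (head G e) - \<phi> (tail G e)))"
    by (rule path_flow_pairing[OF assms])
  also have "\<dots> = (\<Sum>p | apath s p t. h p * (\<phi> t - \<phi> s))"
    by (intro sum.cong) (auto simp: apath_def awalk_sum_potential)
  also have "\<dots> = q * (\<phi> t - \<phi> s)"
    using assms unfolding path_flow_def by (simp add: sum_distrib_right[symmetric])
  finally show ?thesis .
qed

lemma path_flow_pairing_ge:
  assumes "path_flow G s t q h f" "\<And>p. apath s p t \<Longrightarrow> \<mu> \<le> (\<Sum>e\<leftarrow>p. g e)"
  shows "q * \<mu> \<le> (\<Sum>e\<in>arcs G. g e * f e)"
proof -
  have "q * \<mu> = (\<Sum>p | apath s p t. h p * \<mu>)"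
    using assms(1) unfolding path_flow_def by (simp add: sum_distrib_right[symmetric])
  also have "\<dots> \<le> (\<Sum>p | apath s p t. h p * (\<Sum>e\<leftarrow>p. g e))"
    using assms unfolding path_flow_def by (intro sum_mono mult_left_mono) auto
  also have "\<dots> = (\<Sum>e\<in>arcs G. g e * f e)"
    by (rule path_flow_pairing[OF assms(1), symmetric])
  finally show ?thesis .
qed

lemma path_flow_bounds:
  assumes "path_flow G s t q h f" "e \<in> arcs G"
  shows "0 \<le> f e" "f e \<le> q"
proof -
  have f: "f e = (\<Sum>p | apath s p t \<and> e \<in> set p. h p)"
    and h: "\<And>p. apath s p t \<Longrightarrow> 0 \<le> h p" and q: "q = (\<Sum>p | apath s p t. h p)"
    using assms unfolding path_flow_def by auto
  show "0 \<le> f e" unfolding f by (rule sum_nonneg) (use h in auto)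
  show "f e \<le> q" unfolding f q by (rule sum_mono2) (use h apaths_finite in auto)
qed

text \<open>Up to sign, the net outflow is the pairing with the gradient of the indicator of
  \<open>v\<close>, a form to which \<open>path_flow_potential\<close> applies.\<close>

lemma net_outflow_conv:
  "net_outflow G f v =
     - (\<Sum>e\<in>arcs G. ((if head G e = v then 1 else 0) - (if tail G e = v then 1 else 0)) * f e)"
proof -
  have "(\<Sum>e\<in>out_arcs G v. f e) = (\<Sum>e\<in>arcs G. (if tail G e = v then 1 else 0) * f e)"
    unfolding out_arcs_def by (simp add: sum.inter_filter if_distrib if_distribR cong: if_cong)
  moreover have "(\<Sum>e\<in>in_arcs G v. f e) = (\<Sum>e\<in>arcs G. (if head G e = v then 1 else 0) * f e)"
    unfolding in_arcs_def by (simp add: sum.inter_filter if_distrib if_distribR cong: if_cong)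
  ultimately show ?thesis
    unfolding net_outflow_def by (simp add: left_diff_distrib sum_subtractf)
qed

lemma path_flow_net_outflow:
  assumes "path_flow G s t q h f"
  shows "net_outflow G f v = q * ((if s = v then 1 else 0) - (if t = v then 1 else 0))"
  unfolding net_outflow_conv path_flow_potential[OF assms, of "\<lambda>x. if x = v then 1 else 0"]
  by (simp add: algebra_simps)

lemma path_flow_feasible:
  assumes "path_flow G s t q h f" "s \<noteq> t"
  shows "feasible_flow G s t q f"
  using assms(2) path_flow_bounds[OF assms(1)]
  unfolding feasible_flow_def path_flow_net_outflow[OF assms(1)] by auto

text \<open>The equilibrium condition leaves the total of \<open>h\<close> open; the net outflow at
  \<open>s\<close> determines it because \<open>s \<noteq> t\<close>.\<close>

lemma user_equilibrium_path_flow: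
  assumes "user_equilibrium G s t q lat f" "s \<noteq> t"
  obtains h where "path_flow G s t q h f"
    "\<And>p p'. apath s p t \<Longrightarrow> 0 < h p \<Longrightarrow> apath s p' t \<Longrightarrow>
       path_latency lat f p \<le> path_latency lat f p'"
proof -
  obtain h where h: "\<And>p. apath s p t \<Longrightarrow> 0 \<le> h p"
    "\<And>e. e \<in> arcs G \<Longrightarrow> f e = (\<Sum>p | apath s p t \<and> e \<in> set p. h p)"
    "\<And>p p'. apath s p t \<Longrightarrow> 0 < h p \<Longrightarrow> apath s p' t \<Longrightarrow>
       path_latency lat f p \<le> path_latency lat f p'"
    using assms(1) unfolding user_equilibrium_def by blast
  define Q where "Q = (\<Sum>p | apath s p t. h p)"
  have *: "path_flow G s t Q h f"
    using h unfolding path_flow_def Q_def by auto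
  have "net_outflow G f s = q"
    using assms(1) unfolding user_equilibrium_def feasible_flow_def by blast
  then have "Q = q"
    using path_flow_net_outflow[OF *, of s] assms(2) by simp
  with that * h(3) show ?thesis by blast
qed

lemma user_equilibrium_imp_path_flow:
  "user_equilibrium G s t q lat f \<Longrightarrow> s \<noteq> t \<Longrightarrow> \<exists>h. path_flow G s t q h f"
  using user_equilibrium_path_flow by blast

text \<open>All used paths share one latency \<open>\<mu>\<close>, and the cost is the pairing of
  the flow with its own latencies. A used path exists since \<open>0 < q\<close>.\<close>

lemma user_equilibrium_latency:
  assumes "user_equilibrium G s t q lat f" "s \<noteq> t" "0 < q"
  obtains \<mu> where "flow_cost G lat f = q * \<mu>"
    "\<And>p. apath s p t \<Longrightarrow> \<mu> \<le> path_latency lat f p"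
proof -
  obtain h where h: "path_flow G s t q h f" and
    eq: "\<And>p p'. apath s p t \<Longrightarrow> 0 < h p \<Longrightarrow> apath s p' t \<Longrightarrow>
       path_latency lat f p \<le> path_latency lat f p'"
    using user_equilibrium_path_flow[OF assms(1,2)] by blast
  have hnn: "\<And>p. apath s p t \<Longrightarrow> 0 \<le> h p" and sum: "(\<Sum>p | apath s p t. h p) = q"
    using h unfolding path_flow_def by auto
  have "\<exists>p. apath s p t \<and> 0 < h p"
  proof (rule ccontr)
    assume "\<not> ?thesis"
    then have "(\<Sum>p | apath s p t. h p) \<le> 0"
      by (intro sum_nonpos) (auto simp: not_less)
    with sum assms(3) show False by simp
  qed
  then obtain p0 where p0: "apath s p0 t" "0 < h p0" by blast
  define \<mu> where "\<mu> = path_latency lat f p0"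
  have "flow_cost G lat f = (\<Sum>e\<in>arcs G. lat e (f e) * f e)"
    unfolding flow_cost_def by (simp add: mult.commute)
  also have "\<dots> = (\<Sum>p | apath s p t. h p * path_latency lat f p)"
    unfolding path_latency_def by (rule path_flow_pairing[OF h])
  also have "\<dots> = (\<Sum>p | apath s p t. h p * \<mu>)"
  proof (rule sum.cong[OF refl])
    fix p assume "p \<in> {p. apath s p t}"
    then have p: "apath s p t" by simp
    show "h p * path_latency lat f p = h p * \<mu>"
    proof (cases "h p = 0")
      case False
      then have "0 < h p" using hnn[OF p] by simp
      then have "path_latency lat f p = \<mu>"
        unfolding \<mu>_def using eq[OF p _ p0(1)] eq[OF p0 p] by simp
      then show ?thesis by simp
    qed simp
  qed
  also have "\<dots> = q * \<mu>" using sum by (simp add: sum_distrib_right[symmetric])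
  finally show ?thesis
    using that eq[OF p0] unfolding \<mu>_def by blast
qed

text \<open>With latencies frozen at \<open>f\<close>, every path flow pays at least
  \<open>\<mu>\<close> per unit, and \<open>f\<close> pays exactly \<open>\<mu>\<close>.\<close>

lemma user_equilibrium_variational:
  assumes "user_equilibrium G s t q lat f" "s \<noteq> t" "0 < q" "path_flow G s t q h' f'"
  shows "flow_cost G lat f \<le> (\<Sum>e\<in>arcs G. lat e (f e) * f' e)"
proof -
  obtain \<mu> where \<mu>: "flow_cost G lat f = q * \<mu>"
    "\<And>p. apath s p t \<Longrightarrow> \<mu> \<le> path_latency lat f p"
    using user_equilibrium_latency[OF assms(1-3)] by blast
  then show ?thesis
    using path_flow_pairing_ge[OF assms(4)] unfolding path_latency_def by simp
qed

text \<open>Adding the variational inequalities of the two equilibria against each other makes the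
  \<open>\<alpha>\<close>-weighted squared distance nonpositive. This determines the flow only on
  arcs of positive slope.\<close>

lemma user_equilibrium_unique:
  assumes "user_equilibrium G s t q (\<lambda>e x. \<alpha> e * x + \<beta> e) f"
    "user_equilibrium G s t q (\<lambda>e x. \<alpha> e * x + \<beta> e) f'"
    "s \<noteq> t" "0 < q" "\<And>e. e \<in> arcs G \<Longrightarrow> 0 \<le> \<alpha> e"
    "e \<in> arcs G" "0 < \<alpha> e"
  shows "f e = f' e"
proof -
  let ?lat = "\<lambda>e x. \<alpha> e * x + \<beta> e"
  obtain h where h: "path_flow G s t q h f"
    using user_equilibrium_imp_path_flow[OF assms(1,3)] by blast
  obtain h' where h': "path_flow G s t q h' f'"
    using user_equilibrium_imp_path_flow[OF assms(2,3)] by blast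
  have "(\<Sum>e\<in>arcs G. \<alpha> e * (f e - f' e)\<^sup>2)
      = (flow_cost G ?lat f - (\<Sum>e\<in>arcs G. ?lat e (f e) * f' e))
      + (flow_cost G ?lat f' - (\<Sum>e\<in>arcs G. ?lat e (f' e) * f e))"
    unfolding flow_cost_def sum_subtractf[symmetric] sum.distrib[symmetric]
    by (intro sum.cong) (auto simp: algebra_simps power2_eq_square)
  also have "\<dots> \<le> 0"
    using user_equilibrium_variational[OF assms(1,3,4) h']
      user_equilibrium_variational[OF assms(2,3,4) h] by simp
  finally have "(\<Sum>e\<in>arcs G. \<alpha> e * (f e - f' e)\<^sup>2) = 0"
    using assms(5) by (intro antisym sum_nonneg) auto
  then have "\<alpha> e * (f e - f' e)\<^sup>2 = 0"
    using assms(5,6) by (subst (asm) sum_nonneg_eq_0_iff) auto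
  with assms(7) show ?thesis by simp
qed

end

section \<open>Existence of equilibria by minimizing the Beckmann potential\<close>

lemma first_order_nonneg:
  fixes A B c :: real
  assumes "0 < c" "\<And>\<epsilon>. 0 < \<epsilon> \<Longrightarrow> \<epsilon> \<le> c \<Longrightarrow> 0 \<le> \<epsilon> * A + \<epsilon>\<^sup>2 * B"
  shows "0 \<le> A"
proof (rule tendsto_lowerbound)
  show "((\<lambda>\<epsilon>. A + \<epsilon> * B) \<longlongrightarrow> A) (at_right 0)"
    by (auto intro!: tendsto_eq_intros)
  show "\<forall>\<^sub>F \<epsilon> in at_right 0. 0 \<le> A + \<epsilon> * B"
    unfolding eventually_at_right[OF \<open>0 < c\<close>]
  proof (intro exI[of _ c] conjI allI impI \<open>0 < c\<close>)
    fix \<epsilon> :: real assume "0 < \<epsilon>" "\<epsilon> < c"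
    then have "0 \<le> \<epsilon> * (A + \<epsilon> * B)"
      using assms(2)[of \<epsilon>] by (simp add: algebra_simps power2_eq_square)
    with \<open>0 < \<epsilon>\<close> show "0 \<le> A + \<epsilon> * B" by (simp add: zero_le_mult_iff)
  qed
qed simp

text \<open>The set is closed in a product of compact intervals and singletons, which is compact by
  Tychonoff; vanishing off \<open>P\<close> supplies the singletons.\<close>

lemma compact_scaled_simplex:
  fixes P :: "'b set" and q :: real
  assumes "finite P"
  shows "compact {h :: 'b \<Rightarrow> real. (\<forall>p\<in>P. 0 \<le> h p) \<and> (\<forall>p. p \<notin> P \<longrightarrow> h p = 0) \<and> sum h P = q}"
    (is "compact ?K")
proof -
  let ?B = "PiE UNIV (\<lambda>p. if p \<in> P then {0..q} else {0}) :: ('b \<Rightarrow> real) set"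
  have "compactin (product_topology (\<lambda>_. euclidean) UNIV) ?B"
    by (subst compactin_PiE) auto
  then have "compact ?B"
    by (simp add: euclidean_product_topology)
  moreover have "closed {h :: 'b \<Rightarrow> real. sum h P = q}"
    by (intro closed_Collect_eq continuous_intros continuous_on_product_coordinates)
  moreover have "?K = ?B \<inter> {h. sum h P = q}"
  proof (rule set_eqI)
    fix h :: "'b \<Rightarrow> real"
    show "h \<in> ?K \<longleftrightarrow> h \<in> ?B \<inter> {h. sum h P = q}"
    proof
      assume h: "h \<in> ?K"
      have "h p \<le> q" if "p \<in> P" for p
        using member_le_sum[OF that, of h] h assms by auto
      with h show "h \<in> ?B \<inter> {h. sum h P = q}" by (auto simp: PiE_UNIV_domain Pi_iff)
    next
      assume h: "h \<in> ?B \<inter> {h. sum h P = q}"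
      have B: "h p \<in> (if p \<in> P then {0..q} else {0})" for p using h by (auto simp: PiE_iff)
      have "0 \<le> h p" if "p \<in> P" for p using B[of p] that by simp
      moreover have "h p = 0" if "p \<notin> P" for p using B[of p] that by simp
      ultimately show "h \<in> ?K" using h by simp
    qed
  qed
  ultimately show ?thesis by (simp add: compact_Int_closed)
qed

lemma (in fin_digraph) user_equilibrium_exists:
  assumes "s \<noteq> t" "0 \<le> q" "apath s p0 t"
  shows "\<exists>f. user_equilibrium G s t q (\<lambda>e x. \<alpha> e * x + \<beta> e) f"
proof -
  let ?lat = "\<lambda>e x. \<alpha> e * x + \<beta> e"
  define P where "P = {p. apath s p t}"
  have finP: "finite P" unfolding P_def by (rule apaths_finite)
  define F :: "('b list \<Rightarrow> real) \<Rightarrow> 'b \<Rightarrow> real"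
    where "F h e = (\<Sum>p\<in>P. h p * (if e \<in> set p then 1 else 0))" for h e
  \<comment> \<open>The Beckmann potential for affine latencies, as a function of the path
    flows.\<close>
  define Z where "Z h = (\<Sum>e\<in>arcs G. \<alpha> e / 2 * (F h e)\<^sup>2 + \<beta> e * F h e)" for h
  define K where "K = {h :: 'b list \<Rightarrow> real. (\<forall>p\<in>P. 0 \<le> h p) \<and> (\<forall>p. p \<notin> P \<longrightarrow> h p = 0) \<and> sum h P = q}"
  have "continuous_on K Z"
    unfolding Z_def F_def
    by (intro continuous_intros continuous_on_subset[OF continuous_on_product_coordinates]) auto
  moreover have "(\<lambda>p. if p = p0 then q else 0) \<in> K"
    using assms(2,3) finP by (auto simp: P_def K_def)
  then have "K \<noteq> {}" by blast
  ultimately obtain h where hK: "h \<in> K" and hmin: "\<And>h'. h' \<in> K \<Longrightarrow> Z h \<le> Z h'"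
    using continuous_attains_inf[OF compact_scaled_simplex[OF finP, of q, folded K_def]] by blast
  have flow: "F h e = (\<Sum>p | apath s p t \<and> e \<in> set p. h p)" for e
    unfolding F_def P_def using apaths_finite
    by (simp add: sum.inter_filter[symmetric] if_distrib cong: if_cong)
  then have pf: "path_flow G s t q h (F h)"
    using hK unfolding path_flow_def P_def K_def by auto
  have opt: "path_latency ?lat (F h) p \<le> path_latency ?lat (F h) p'"
    if p: "apath s p t" "0 < h p" and p': "apath s p' t" for p p'
  proof (cases "p = p'")
    case False
    \<comment> \<open>Move \<open>\<epsilon>\<close> units from \<open>p\<close> to
      \<open>p'\<close>, which is feasible as long as \<open>\<epsilon> \<le> h p\<close>. Along
      this direction the first-order change of \<open>Z\<close> is the latency of \<open>p'\<close>
      minus that of \<open>p\<close>, and minimality makes it nonnegative.\<close>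
    define D :: "'b \<Rightarrow> real"
      where "D e = (if e \<in> set p' then 1 else 0) - (if e \<in> set p then 1 else 0)" for e
    have "0 \<le> (\<Sum>e\<in>arcs G. ?lat e (F h e) * D e)"
    proof (rule first_order_nonneg[OF p(2), where B = "\<Sum>e\<in>arcs G. \<alpha> e / 2 * (D e)\<^sup>2"])
      fix \<epsilon> :: real assume \<epsilon>: "0 < \<epsilon>" "\<epsilon> \<le> h p"
      define h' where "h' x = h x + \<epsilon> * ((if x = p' then 1 else 0) - (if x = p then 1 else 0))" for x
      have PP: "p \<in> P" "p' \<in> P" using p p' by (auto simp: P_def)
      have "sum h' P = sum h P"
        unfolding h'_def sum.distrib sum_distrib_left[symmetric] sum_subtractf
        using PP finP by simp
      then have "h' \<in> K"
        using hK \<epsilon> PP False by (auto simp: h'_def K_def)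
      then have "Z h \<le> Z h'" by (rule hmin)
      moreover have "F h' e = F h e + \<epsilon> * D e" for e
      proof -
        have "F h' e = (\<Sum>x\<in>P. h x * (if e \<in> set x then 1 else 0)
            + \<epsilon> * ((if x = p' then if e \<in> set x then 1 else 0 else 0)
                 - (if x = p then if e \<in> set x then 1 else 0 else 0)))"
          unfolding F_def h'_def by (intro sum.cong) (auto simp: algebra_simps)
        also have "\<dots> = F h e + \<epsilon> * D e"
          unfolding sum.distrib sum_distrib_left[symmetric] sum_subtractf F_def D_def
          using PP finP by simp
        finally show ?thesis .
      qed
      then have "Z h' - Z h = \<epsilon> * (\<Sum>e\<in>arcs G. ?lat e (F h e) * D e)
          + \<epsilon>\<^sup>2 * (\<Sum>e\<in>arcs G. \<alpha> e / 2 * (D e)\<^sup>2)"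
        unfolding Z_def sum_subtractf[symmetric] sum_distrib_left sum.distrib[symmetric]
        by (intro sum.cong) (auto simp: field_simps power2_eq_square)
      ultimately show "0 \<le> \<epsilon> * (\<Sum>e\<in>arcs G. ?lat e (F h e) * D e)
          + \<epsilon>\<^sup>2 * (\<Sum>e\<in>arcs G. \<alpha> e / 2 * (D e)\<^sup>2)" by simp
    qed
    moreover have "(\<Sum>e\<in>arcs G. ?lat e (F h e) * (if e \<in> set x then 1 else 0))
        = path_latency ?lat (F h) x" if "apath s x t" for x
    proof -
      have "(\<Sum>e\<in>arcs G. ?lat e (F h e) * (if e \<in> set x then 1 else 0))
          = (\<Sum>e\<in>set x. ?lat e (F h e))"
        using apath_arcs[OF that] by (intro sum.mono_neutral_cong_right) auto
      also have "\<dots> = path_latency ?lat (F h) x"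
        unfolding path_latency_def
        using apath_distinct[OF that] by (rule sum.distinct_set_conv_list)
      finally show ?thesis .
    qed
    ultimately show ?thesis
      using p(1) p' unfolding D_def right_diff_distrib sum_subtractf by simp
  qed simp
  have "user_equilibrium G s t q ?lat (F h)"
    unfolding user_equilibrium_def
  proof (intro conjI exI[of _ h])
    show "feasible_flow G s t q (F h)" by (rule path_flow_feasible[OF pf assms(1)])
  qed (use hK opt flow in \<open>auto simp: P_def K_def\<close>)
  then show ?thesis by blast
qed

section \<open>The electrical flow on the grid\<close>

text \<open>Faces of the grid are indexed with a shift by one, so that the inner faces have
  coordinates in \<open>{1..m} \<times> {1..n}\<close>; the boundary value is 1 on the left and above, and 0 below
  and on the right. Averaging repeatedly from these data preserves monotonicity in both
  coordinates and increases pointwise.\<close>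

fun dirichlet_iter :: "nat \<Rightarrow> nat \<Rightarrow> nat \<Rightarrow> nat \<Rightarrow> nat \<Rightarrow> real" where
  "dirichlet_iter m n 0 i j = (if i = 0 \<or> n < j then 1 else 0)"
| "dirichlet_iter m n (Suc k) i j =
    (if 1 \<le> i \<and> i \<le> m \<and> 1 \<le> j \<and> j \<le> n
     then (dirichlet_iter m n k (i - 1) j + dirichlet_iter m n k (i + 1) j
         + dirichlet_iter m n k i (j - 1) + dirichlet_iter m n k i (j + 1)) / 4
     else if i = 0 \<or> n < j then 1 else 0)"

lemma dirichlet_iter_bounds: "0 \<le> dirichlet_iter m n k i j \<and> dirichlet_iter m n k i j \<le> 1"
proof (induction k arbitrary: i j)
  case (Suc k)
  have "0 \<le> dirichlet_iter m n k x y" "dirichlet_iter m n k x y \<le> 1" for x y using Suc by auto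
  from this[of "i - 1" j] this[of "i + 1" j] this[of i "j - 1"] this[of i "j + 1"]
  show ?case by auto
qed auto

lemma dirichlet_iter_boundary:
  "\<not> (1 \<le> i \<and> i \<le> m \<and> 1 \<le> j \<and> j \<le> n) \<Longrightarrow>
    dirichlet_iter m n k i j = (if i = 0 \<or> n < j then 1 else 0)"
  by (cases k) auto

text \<open>Where both values are averages, the induction hypothesis compares neighbour with
  neighbour. Otherwise the left value is the boundary value 1 or the right one is the boundary value
  0, and all values lie between these.\<close>

lemma dirichlet_iter_antimono_fst: "dirichlet_iter m n k (Suc i) j \<le> dirichlet_iter m n k i j"
proof (induction k arbitrary: i j)
  case (Suc k)
  show ?case
  proof (cases "1 \<le> i \<and> i < m \<and> 1 \<le> j \<and> j \<le> n")
    case True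
    then have "dirichlet_iter m n k i j \<le> dirichlet_iter m n k (i - 1) j"
      using Suc[of "i - 1" j] by simp
    with True Suc[of "i + 1" j] Suc[of i "j - 1"] Suc[of i "j + 1"] show ?thesis
      by (simp add: divide_right_mono add_mono)
  next
    case False
    show ?thesis
    proof (cases "i = 0 \<or> n < j")
      case True
      then have "dirichlet_iter m n (Suc k) i j = 1"
        by (subst dirichlet_iter_boundary) auto
      then show ?thesis using dirichlet_iter_bounds[of m n "Suc k"] by metis
    next
      case False
      with \<open>\<not> (1 \<le> i \<and> _)\<close> have "dirichlet_iter m n (Suc k) (Suc i) j = 0"
        by (subst dirichlet_iter_boundary) auto
      then show ?thesis using dirichlet_iter_bounds[of m n "Suc k"] by metis
    qed
  qed
qed simp

lemma dirichlet_iter_mono_snd: "dirichlet_iter m n k i j \<le> dirichlet_iter m n k i (Suc j)"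
proof (induction k arbitrary: i j)
  case (Suc k)
  show ?case
  proof (cases "1 \<le> i \<and> i \<le> m \<and> 1 \<le> j \<and> j < n")
    case True
    then have "dirichlet_iter m n k i (j - 1) \<le> dirichlet_iter m n k i j"
      using Suc[of i "j - 1"] by simp
    with True Suc[of i "j + 1"] Suc[of "i - 1" j] Suc[of "i + 1" j] show ?thesis
      by (simp add: divide_right_mono add_mono)
  next
    case False
    show ?thesis
    proof (cases "i = 0 \<or> n \<le> j")
      case True
      then have "dirichlet_iter m n (Suc k) i (Suc j) = 1"
        by (subst dirichlet_iter_boundary) auto
      then show ?thesis using dirichlet_iter_bounds[of m n "Suc k"] by metis
    next
      case False
      with \<open>\<not> (1 \<le> i \<and> _)\<close> have "dirichlet_iter m n (Suc k) i j = 0"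
        by (subst dirichlet_iter_boundary) auto
      then show ?thesis using dirichlet_iter_bounds[of m n "Suc k"] by metis
    qed
  qed
qed simp

text \<open>The iteration starts from 0 on the inner faces, so the first averaging can only raise
  the values, and averaging preserves order.\<close>

lemma incseq_dirichlet_iter: "incseq (\<lambda>k. dirichlet_iter m n k i j)"
proof (rule incseq_SucI)
  fix k
  show "dirichlet_iter m n k i j \<le> dirichlet_iter m n (Suc k) i j"
  proof (induction k arbitrary: i j)
    case 0
    then show ?case by auto
  next
    case (Suc k)
    show ?case
      unfolding dirichlet_iter.simps(2)[of m n k i j] dirichlet_iter.simps(2)[of m n "Suc k" i j]
      using Suc[of "i - 1" j] Suc[of "i + 1" j] Suc[of i "j - 1"] Suc[of i "j + 1"]
      by (simp del: dirichlet_iter.simps)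
  qed
qed

text \<open>Take the pointwise limit of the bounded increasing iterates: weak inequalities survive,
  and the averaging rule becomes harmonicity. The corners are left out of the boundary conditions
  since no grid arc borders them.\<close>

lemma discrete_dirichlet:
  fixes m n :: nat
  obtains \<psi> :: "nat \<Rightarrow> nat \<Rightarrow> real" where
    "\<And>i j. \<psi> (Suc i) j \<le> \<psi> i j" "\<And>i j. \<psi> i j \<le> \<psi> i (Suc j)"
    "\<And>j. j < n \<Longrightarrow> \<psi> 0 (Suc j) = 1" "\<And>j. j < n \<Longrightarrow> \<psi> (Suc m) (Suc j) = 0"
    "\<And>i. i < m \<Longrightarrow> \<psi> (Suc i) 0 = 0" "\<And>i. i < m \<Longrightarrow> \<psi> (Suc i) (Suc n) = 1"
    "\<And>i j. i < m \<Longrightarrow> j < n \<Longrightarrow> 4 * \<psi> (Suc i) (Suc j) =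
       \<psi> i (Suc j) + \<psi> (Suc (Suc i)) (Suc j) + \<psi> (Suc i) j + \<psi> (Suc i) (Suc (Suc j))"
proof -
  let ?g = "dirichlet_iter m n"
  define \<psi> where "\<psi> i j = lim (\<lambda>k. ?g k i j)" for i j
  have lim: "(\<lambda>k. ?g k i j) \<longlonglongrightarrow> \<psi> i j" for i j
  proof -
    obtain L where "(\<lambda>k. ?g k i j) \<longlonglongrightarrow> L"
      using incseq_convergent[OF incseq_dirichlet_iter] dirichlet_iter_bounds by metis
    then show ?thesis unfolding \<psi>_def using limI by blast
  qed
  have bd: "\<psi> i j = (if i = 0 \<or> n < j then 1 else 0)" if "\<not> (1 \<le> i \<and> i \<le> m \<and> 1 \<le> j \<and> j \<le> n)" for i j
    using lim[of i j] unfolding dirichlet_iter_boundary[OF that] by (simp only: LIMSEQ_const_iff)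
  have "4 * \<psi> (Suc i) (Suc j) =
       \<psi> i (Suc j) + \<psi> (Suc (Suc i)) (Suc j) + \<psi> (Suc i) j + \<psi> (Suc i) (Suc (Suc j))"
    if "i < m" "j < n" for i j
  proof -
    have "(\<lambda>k. ?g (Suc k) (Suc i) (Suc j)) \<longlonglongrightarrow>
      (\<psi> i (Suc j) + \<psi> (Suc (Suc i)) (Suc j) + \<psi> (Suc i) j + \<psi> (Suc i) (Suc (Suc j))) / 4"
      using that by (simp, intro tendsto_intros lim) auto
    moreover have "(\<lambda>k. ?g (Suc k) (Suc i) (Suc j)) \<longlonglongrightarrow> \<psi> (Suc i) (Suc j)"
      by (rule LIMSEQ_Suc[OF lim])
    ultimately show ?thesis using LIMSEQ_unique by fastforce
  qed
  moreover have "\<psi> (Suc i) j \<le> \<psi> i j" for i j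
    by (rule LIMSEQ_le[OF lim lim]) (use dirichlet_iter_antimono_fst in blast)
  moreover have "\<psi> i j \<le> \<psi> i (Suc j)" for i j
    by (rule LIMSEQ_le[OF lim lim]) (use dirichlet_iter_mono_snd in blast)
  ultimately show ?thesis
    by (intro that[of \<psi>]) (auto simp: bd)
qed

section \<open>Arcs of the grid and the potential of its electrical flow\<close>

lemma tail_grid [simp]: "tail (grid m n) = fst" and head_grid [simp]: "head (grid m n) = snd"
  by (simp_all add: grid_def)

lemma grid_arcs_eq:
  "arcs (grid m n) = (\<lambda>(i, j). ((i, j), (Suc i, j))) ` ({..<m} \<times> {..n})
     \<union> (\<lambda>(i, j). ((i, j), (i, Suc j))) ` ({..m} \<times> {..<n})"
  by (auto simp: grid_def image_def)

lemma grid_arcE: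
  assumes "e \<in> arcs (grid m n)"
  obtains i j where "e = ((i, j), (Suc i, j))" "i < m" "j \<le> n"
    | i j where "e = ((i, j), (i, Suc j))" "i \<le> m" "j < n"
  using assms by (auto simp: grid_def)

lemma grid_arc_right: "i < m \<Longrightarrow> j \<le> n \<Longrightarrow> ((i, j), (Suc i, j)) \<in> arcs (grid m n)"
  and grid_arc_up: "i \<le> m \<Longrightarrow> j < n \<Longrightarrow> ((i, j), (i, Suc j)) \<in> arcs (grid m n)"
  by (auto simp: grid_def)

lemma fin_digraph_grid: "fin_digraph (grid m n)"
proof
  show "finite (arcs (grid m n))" unfolding grid_arcs_eq by simp
qed (auto simp: grid_def)

text \<open>The inner sums run over the parallel arcs between two neighbouring columns or rows, the
  direction in which summation by parts is applied later.\<close>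

lemma grid_sum:
  "(\<Sum>e\<in>arcs (grid m n). F e) =
     (\<Sum>i<m. \<Sum>j\<le>n. F ((i, j), (Suc i, j))) + (\<Sum>j<n. \<Sum>i\<le>m. F ((i, j), (i, Suc j)))"
proof -
  have "(\<Sum>e\<in>arcs (grid m n). F e)
     = (\<Sum>e\<in>(\<lambda>(i, j). ((i, j), (Suc i, j))) ` ({..<m} \<times> {..n}). F e)
     + (\<Sum>e\<in>(\<lambda>(i, j). ((i, j), (i, Suc j))) ` ({..m} \<times> {..<n}). F e)"
    unfolding grid_arcs_eq by (intro sum.union_disjoint) auto
  also have "(\<Sum>e\<in>(\<lambda>(i, j). ((i, j), (Suc i, j))) ` ({..<m} \<times> {..n}). F e)
      = (\<Sum>i<m. \<Sum>j\<le>n. F ((i, j), (Suc i, j)))"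
    by (subst sum.reindex) (auto simp: inj_on_def sum.cartesian_product case_prod_unfold)
  also have "(\<Sum>e\<in>(\<lambda>(i, j). ((i, j), (i, Suc j))) ` ({..m} \<times> {..<n}). F e)
      = (\<Sum>i\<le>m. \<Sum>j<n. F ((i, j), (i, Suc j)))"
    by (subst sum.reindex) (auto simp: inj_on_def sum.cartesian_product case_prod_unfold)
  also have "\<dots> = (\<Sum>j<n. \<Sum>i\<le>m. F ((i, j), (i, Suc j)))"
    by (rule sum.swap)
  finally show ?thesis .
qed

lemma sum_by_parts:
  fixes g h :: "nat \<Rightarrow> real"
  shows "(\<Sum>j\<le>n. (g (Suc j) - g j) * h j)
    = g (Suc n) * h n - g 0 * h 0 - (\<Sum>j<n. g (Suc j) * (h (Suc j) - h j))"
  by (induction n) (simp_all add: algebra_simps)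

text \<open>In weak form, with test functions \<open>\<phi>\<close>, the second property says that
  the gradient of \<open>V\<close> is a unit flow from corner to corner. The first says that this
  flow respects the arc directions; it comes from the monotonicity of \<open>\<psi>\<close>.\<close>

lemma grid_electrical_potential:
  fixes m n :: nat
  obtains V :: "vertex \<Rightarrow> real" where
    "\<And>e. e \<in> arcs (grid m n) \<Longrightarrow> V (fst e) \<le> V (snd e)"
    "\<And>\<phi> :: vertex \<Rightarrow> real.
       (\<Sum>e\<in>arcs (grid m n). (V (snd e) - V (fst e)) * (\<phi> (snd e) - \<phi> (fst e)))
         = \<phi> (m, n) - \<phi> (0, 0)"
proof -
  obtain \<psi> :: "nat \<Rightarrow> nat \<Rightarrow> real" where
    mono: "\<And>i j. \<psi> (Suc i) j \<le> \<psi> i j" "\<And>i j. \<psi> i j \<le> \<psi> i (Suc j)" and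
    bd: "\<And>j. j < n \<Longrightarrow> \<psi> 0 (Suc j) = 1" "\<And>j. j < n \<Longrightarrow> \<psi> (Suc m) (Suc j) = 0"
    "\<And>i. i < m \<Longrightarrow> \<psi> (Suc i) 0 = 0" "\<And>i. i < m \<Longrightarrow> \<psi> (Suc i) (Suc n) = 1" and
    harm: "\<And>i j. i < m \<Longrightarrow> j < n \<Longrightarrow> 4 * \<psi> (Suc i) (Suc j) =
       \<psi> i (Suc j) + \<psi> (Suc (Suc i)) (Suc j) + \<psi> (Suc i) j + \<psi> (Suc i) (Suc (Suc j))"
    by (rule discrete_dirichlet[of n m]) blast
  \<comment> \<open>\<open>\<psi>\<close> is the stream function of the flow: an arc carries the difference of \<open>\<psi>\<close> across it,
    and harmonicity of \<open>\<psi>\<close> at a face says that this flow is a gradient around that face.\<close>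
  define V :: "vertex \<Rightarrow> real" where "V = (\<lambda>(i, j). (\<Sum>k<i. \<psi> (Suc k) 1 - \<psi> (Suc k) 0)
    + (\<Sum>k<j. \<psi> i (Suc k) - \<psi> (Suc i) (Suc k)))"
  have up: "V (i, Suc j) - V (i, j) = \<psi> i (Suc j) - \<psi> (Suc i) (Suc j)" for i j
    by (simp add: V_def)
  \<comment> \<open>\<open>V\<close> integrates the flow along the bottom row and then up a column.
    For the horizontal arcs the induction climbs row by row, using harmonicity at the face between
    two rows.\<close>
  have right: "V (Suc i, j) - V (i, j) = \<psi> (Suc i) (Suc j) - \<psi> (Suc i) j"
    if "i < m" "j \<le> n" for i j
    using that(2)
  proof (induction j)
    case 0
    show ?case by (simp add: V_def)
  next
    case (Suc j)
    then show ?case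
      using up[of "Suc i" j] up[of i j] harm[OF \<open>i < m\<close>, of j] by simp
  qed
  have "(\<Sum>e\<in>arcs (grid m n). (V (snd e) - V (fst e)) * (\<phi> (snd e) - \<phi> (fst e)))
         = \<phi> (m, n) - \<phi> (0, 0)" for \<phi> :: "vertex \<Rightarrow> real"
  proof -
    \<comment> \<open>\<open>T i j\<close> is the mixed second difference of \<open>\<phi>\<close>
      around a face, weighted by \<open>\<psi>\<close>. It arises with opposite signs from the
      horizontal and the vertical arcs; the boundary terms that remain telescope along the left
      column and the top row, where \<open>\<psi>\<close> is 1 outside.\<close>
    define T where "T i j = \<psi> (Suc i) (Suc j)
      * (\<phi> (Suc i, Suc j) - \<phi> (i, Suc j) - (\<phi> (Suc i, j) - \<phi> (i, j)))" for i j
    have "(\<Sum>i<m. \<Sum>j\<le>n. (V (Suc i, j) - V (i, j)) * (\<phi> (Suc i, j) - \<phi> (i, j)))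
        = (\<Sum>i<m. \<phi> (Suc i, n) - \<phi> (i, n) - (\<Sum>j<n. T i j))"
    proof (rule sum.cong[OF refl])
      fix i assume "i \<in> {..<m}"
      then have i: "i < m" by simp
      have "(\<Sum>j\<le>n. (V (Suc i, j) - V (i, j)) * (\<phi> (Suc i, j) - \<phi> (i, j)))
          = (\<Sum>j\<le>n. (\<psi> (Suc i) (Suc j) - \<psi> (Suc i) j) * (\<phi> (Suc i, j) - \<phi> (i, j)))"
        using right[OF i] by simp
      also have "\<dots> = \<phi> (Suc i, n) - \<phi> (i, n) - (\<Sum>j<n. T i j)"
        unfolding sum_by_parts[of "\<psi> (Suc i)"] T_def using bd(3,4)[OF i] by simp
      finally show "(\<Sum>j\<le>n. (V (Suc i, j) - V (i, j)) * (\<phi> (Suc i, j) - \<phi> (i, j)))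
          = \<phi> (Suc i, n) - \<phi> (i, n) - (\<Sum>j<n. T i j)" .
    qed
    also have "\<dots> = \<phi> (m, n) - \<phi> (0, n) - (\<Sum>i<m. \<Sum>j<n. T i j)"
      using sum_lessThan_telescope[of "\<lambda>i. \<phi> (i, n)" m] by (simp add: sum_subtractf)
    finally have 1: "(\<Sum>i<m. \<Sum>j\<le>n. (V (Suc i, j) - V (i, j)) * (\<phi> (Suc i, j) - \<phi> (i, j)))
        = \<phi> (m, n) - \<phi> (0, n) - (\<Sum>i<m. \<Sum>j<n. T i j)" .
    have "(\<Sum>j<n. \<Sum>i\<le>m. (V (i, Suc j) - V (i, j)) * (\<phi> (i, Suc j) - \<phi> (i, j)))
        = (\<Sum>j<n. \<phi> (0, Suc j) - \<phi> (0, j) + (\<Sum>i<m. T i j))"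
    proof (rule sum.cong[OF refl])
      fix j assume "j \<in> {..<n}"
      then have j: "j < n" by simp
      have "(\<Sum>i\<le>m. (V (i, Suc j) - V (i, j)) * (\<phi> (i, Suc j) - \<phi> (i, j)))
          = - (\<Sum>i\<le>m. (\<psi> (Suc i) (Suc j) - \<psi> i (Suc j)) * (\<phi> (i, Suc j) - \<phi> (i, j)))"
        unfolding up sum_negf[symmetric] by (intro sum.cong) (auto simp: algebra_simps)
      also have "\<dots> = \<phi> (0, Suc j) - \<phi> (0, j) + (\<Sum>i<m. T i j)"
        unfolding sum_by_parts[of "\<lambda>i. \<psi> i (Suc j)"] T_def using bd(1,2)[OF j]
        by (simp add: algebra_simps)
      finally show "(\<Sum>i\<le>m. (V (i, Suc j) - V (i, j)) * (\<phi> (i, Suc j) - \<phi> (i, j)))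
          = \<phi> (0, Suc j) - \<phi> (0, j) + (\<Sum>i<m. T i j)" .
    qed
    also have "\<dots> = \<phi> (0, n) - \<phi> (0, 0) + (\<Sum>j<n. \<Sum>i<m. T i j)"
      using sum_lessThan_telescope[of "\<lambda>j. \<phi> (0, j)" n] by (simp add: sum.distrib sum_subtractf)
    also have "(\<Sum>j<n. \<Sum>i<m. T i j) = (\<Sum>i<m. \<Sum>j<n. T i j)" by (rule sum.swap)
    finally show ?thesis using 1 by (simp add: grid_sum)
  qed
  moreover have "V (fst e) \<le> V (snd e)" if "e \<in> arcs (grid m n)" for e
    using that
  proof (cases rule: grid_arcE)
    case (1 i j)
    then show ?thesis using right[of i j] mono(2)[of "Suc i" j] by simp
  next
    case (2 i j)
    then show ?thesis using up[of i j] mono(1)[of i "Suc j"] by simp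
  qed
  ultimately show ?thesis using that by blast
qed

section \<open>Walks and distances in digraphs whose arcs raise a level\<close>

lemma (in wf_digraph) awalk_ranked_imp_apath:
  fixes lev :: "'a \<Rightarrow> nat"
  assumes "\<And>e. e \<in> arcs G \<Longrightarrow> lev (tail G e) < lev (head G e)" "awalk u p v"
  shows "apath u p v"
proof -
  have "distinct (awalk_verts u p) \<and> (\<forall>x\<in>set (awalk_verts u p). lev u \<le> lev x)"
    using assms(2)
  proof (induction p arbitrary: u)
    case (Cons e p)
    then have e: "e \<in> arcs G" "u = tail G e" "awalk (head G e) p v"
      by (auto simp: awalk_simps)
    show ?case using Cons.IH[OF e(3)] assms(1)[OF e(1)] e(2) by fastforce
  qed simp
  with assms(2) show ?thesis unfolding apath_def by blast
qed

text \<open>\<open>D\<close> is the minimal length over the finitely many simple paths from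
  \<open>s\<close>. Appending an arc keeps a path simple because levels rise, which gives the
  triangle inequality.\<close>

lemma (in fin_digraph) ranked_distance:
  fixes lev :: "'a \<Rightarrow> nat" and len :: "'b \<Rightarrow> real"
  assumes lev: "\<And>e. e \<in> arcs G \<Longrightarrow> lev (tail G e) < lev (head G e)"
    and reach: "\<And>v. v \<in> verts G \<Longrightarrow> \<exists>p. apath s p v"
    and "s \<in> verts G"
  obtains D :: "'a \<Rightarrow> real" where "D s = 0"
    "\<And>e. e \<in> arcs G \<Longrightarrow> D (head G e) - D (tail G e) \<le> len e"
    "\<And>v. v \<in> verts G \<Longrightarrow> \<exists>p. apath s p v \<and> D v = (\<Sum>e\<leftarrow>p. len e)"
proof -
  define D where "D v = Min ((\<lambda>p. \<Sum>e\<leftarrow>p. len e) ` {p. apath s p v})" for v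
  have attained: "\<exists>p. apath s p v \<and> D v = (\<Sum>e\<leftarrow>p. len e)" if "v \<in> verts G" for v
  proof -
    have "D v \<in> (\<lambda>p. \<Sum>e\<leftarrow>p. len e) ` {p. apath s p v}"
      unfolding D_def using reach[OF that] apaths_finite by (intro Min_in) auto
    then show ?thesis by blast
  qed
  have le: "D v \<le> (\<Sum>e\<leftarrow>p. len e)" if "apath s p v" for p v
    unfolding D_def using that apaths_finite by (intro Min_le) auto
  have "D s = 0"
  proof -
    obtain p where p: "apath s p s" "D s = (\<Sum>e\<leftarrow>p. len e)" using attained[OF assms(3)] by blast
    then have "p = []" using apath_nonempty_ends by blast
    with p show ?thesis by simp
  qed
  moreover have "D (head G e) - D (tail G e) \<le> len e" if e: "e \<in> arcs G" for e
  proof -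
    obtain p where p: "apath s p (tail G e)" "D (tail G e) = (\<Sum>e\<leftarrow>p. len e)"
      using attained e by (metis tail_in_verts)
    have "awalk s (p @ [e]) (head G e)"
      using p(1) e by (auto simp: apath_def awalk_simps)
    then have "apath s (p @ [e]) (head G e)"
      by (rule awalk_ranked_imp_apath[of lev, rotated]) (rule lev)
    from le[OF this] p(2) show ?thesis by simp
  qed
  ultimately show ?thesis using that attained by blast
qed

lemma grid_rank: "e \<in> arcs (grid m n) \<Longrightarrow> fst (snd e) + snd (snd e) = Suc (fst (fst e) + snd (fst e))"
  by (erule grid_arcE) auto

lemma grid_apath_exists:
  assumes "v \<in> verts (grid m n)"
  shows "\<exists>p. pre_digraph.apath (grid m n) (0, 0) p v"
proof -
  interpret fin_digraph "grid m n" by (rule fin_digraph_grid)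
  have snoc: "\<exists>p. awalk u p (snd e)" if "awalk u p (fst e)" "e \<in> arcs (grid m n)" for u p e
    using that head_in_verts[of e] tail_in_verts[of e]
    by (intro exI[of _ "p @ [e]"]) (auto simp: awalk_simps)
  obtain i j where v: "v = (i, j)" "i \<le> m" "j \<le> n" using assms by (auto simp: grid_def)
  have row: "\<exists>p. awalk (0, 0) p (i, 0)" if "i \<le> m" for i
    using that
  proof (induction i)
    case 0
    have "(0, 0) \<in> verts (grid m n)" by (simp add: grid_def)
    then have "awalk (0, 0) [] (0, 0)" by (simp add: awalk_Nil_iff)
    then show ?case by blast
  next
    case (Suc i)
    then show ?case using snoc[of _ _ "((i, 0), (Suc i, 0))"] grid_arc_right[of i m 0 n] by auto
  qed
  have "\<exists>p. awalk (0, 0) p (i, j)"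
    using v(3)
  proof (induction j)
    case 0
    show ?case by (rule row[OF v(2)])
  next
    case (Suc j)
    then show ?case using snoc[of _ _ "((i, j), (i, Suc j))"] grid_arc_up[of i m j n] v(2) by auto
  qed
  then obtain p where "awalk (0, 0) p v" unfolding v(1) by blast
  then have "apath (0, 0) p v"
    by (rule awalk_ranked_imp_apath[of "\<lambda>x. fst x + snd x", rotated]) (simp add: grid_rank)
  then show ?thesis by blast
qed

section \<open>The Braess ratio of a chord\<close>

text \<open>The electrical flow is never decomposed into paths. Instead the distances under the
  latencies of \<open>f\<close> are used as test function in the weak form, which bounds the energy
  of \<open>f\<close> by that of \<open>q\<close> times the gradient of \<open>V\<close>; the two
  flows have the same pairing with this gradient, so they coincide.\<close>

lemma grid_user_equilibrium:
  fixes V :: "vertex \<Rightarrow> real"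
  assumes V: "\<And>e. e \<in> arcs (grid m n) \<Longrightarrow> V (fst e) \<le> V (snd e)"
    "\<And>\<phi> :: vertex \<Rightarrow> real.
       (\<Sum>e\<in>arcs (grid m n). (V (snd e) - V (fst e)) * (\<phi> (snd e) - \<phi> (fst e)))
         = \<phi> (m, n) - \<phi> (0, 0)"
    and ue: "user_equilibrium (grid m n) (0, 0) (m, n) q (\<lambda>e x. a * x + b) f"
    and "0 < q" "0 < a" "0 < m" "e \<in> arcs (grid m n)"
  shows "f e = q * (V (snd e) - V (fst e))"
proof -
  interpret fin_digraph "grid m n" by (rule fin_digraph_grid)
  let ?A = "arcs (grid m n)"
  define w where "w e = V (snd e) - V (fst e)" for e
  define K where "K = V (m, n) - V (0, 0)"
  have st: "(0, 0) \<noteq> (m, n)" using \<open>0 < m\<close> by simp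
  have rank: "fst (tail (grid m n) e) + snd (tail (grid m n) e)
      < fst (head (grid m n) e) + snd (head (grid m n) e)" if "e \<in> ?A" for e
    using grid_rank[OF that] by simp
  have verts: "(0, 0) \<in> verts (grid m n)" "(m, n) \<in> verts (grid m n)"
    by (simp_all add: grid_def)
  obtain h where h: "path_flow (grid m n) (0, 0) (m, n) q h f"
    using user_equilibrium_imp_path_flow[OF ue st] by blast
  obtain \<mu> where \<mu>: "flow_cost (grid m n) (\<lambda>e x. a * x + b) f = q * \<mu>"
    "\<And>p. apath (0, 0) p (m, n) \<Longrightarrow> \<mu> \<le> path_latency (\<lambda>e x. a * x + b) f p"
    using user_equilibrium_latency[OF ue st \<open>0 < q\<close>] by blast
  obtain D :: "vertex \<Rightarrow> real" where D: "D (0, 0) = 0"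
    "\<And>e. e \<in> ?A \<Longrightarrow> D (snd e) - D (fst e) \<le> a * f e + b"
    "\<And>v. v \<in> verts (grid m n) \<Longrightarrow> \<exists>p. apath (0, 0) p v \<and> D v = (\<Sum>e\<leftarrow>p. a * f e + b)"
    using ranked_distance[of "\<lambda>x. fst x + snd x" "(0, 0)" "\<lambda>e. a * f e + b",
        OF rank grid_apath_exists verts(1)] by auto
  have "\<mu> \<le> D (m, n) - D (0, 0)"
    using D(1) D(3)[OF verts(2)] \<mu>(2) unfolding path_latency_def by auto
  also have "\<dots> = (\<Sum>e\<in>?A. w e * (D (snd e) - D (fst e)))"
    unfolding w_def by (rule V(2)[symmetric])
  \<comment> \<open>This is where the electrical flow must respect the arc directions:
    \<open>w\<close> is nonnegative.\<close>
  also have "\<dots> \<le> (\<Sum>e\<in>?A. w e * (a * f e + b))"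
    using V(1) D(2) unfolding w_def by (intro sum_mono mult_left_mono) auto
  also have "\<dots> = a * (\<Sum>e\<in>?A. w e * f e) + b * (\<Sum>e\<in>?A. w e)"
    by (simp add: sum_distrib_left sum.distrib algebra_simps)
  also have "(\<Sum>e\<in>?A. w e * f e) = q * K"
    using path_flow_potential[OF h, of V] unfolding w_def K_def by simp
  also have "(\<Sum>e\<in>?A. w e) = real (m + n)"
  proof -
    have "(\<Sum>e\<in>?A. w e) = (\<Sum>e\<in>?A. (V (snd e) - V (fst e)) *
        (real (fst (snd e) + snd (snd e)) - real (fst (fst e) + snd (fst e))))"
      by (intro sum.cong) (simp_all add: grid_rank w_def)
    also have "\<dots> = real (m + n)"
      using V(2)[of "\<lambda>x. real (fst x + snd x)"] by simp
    finally show ?thesis .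
  qed
  finally have \<mu>_le: "\<mu> \<le> a * (q * K) + b * real (m + n)" .
  have sum_f: "(\<Sum>e\<in>?A. f e) = q * real (m + n)"
  proof -
    have "(\<Sum>e\<in>?A. f e) = (\<Sum>e\<in>?A.
        (real (fst (snd e) + snd (snd e)) - real (fst (fst e) + snd (fst e))) * f e)"
      by (intro sum.cong) (simp_all add: grid_rank)
    then show ?thesis
      using path_flow_potential[OF h, of "\<lambda>x. real (fst x + snd x)"] by simp
  qed
  have "q * \<mu> = a * (\<Sum>e\<in>?A. f e * f e) + b * (q * real (m + n))"
    unfolding \<mu>(1)[symmetric] flow_cost_def sum_f[symmetric]
    by (simp add: sum_distrib_left sum.distrib[symmetric] algebra_simps)
  moreover have "q * \<mu> \<le> a * (q * q * K) + b * (q * real (m + n))"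
    using mult_left_mono[OF \<mu>_le, of q] \<open>0 < q\<close> by (simp add: algebra_simps)
  ultimately have "a * (\<Sum>e\<in>?A. f e * f e) \<le> a * (q * q * K)" by linarith
  then have energy: "(\<Sum>e\<in>?A. f e * f e) \<le> q * q * K"
    using \<open>0 < a\<close> by simp
  have "(\<Sum>e\<in>?A. (f e - q * w e)\<^sup>2)
      = (\<Sum>e\<in>?A. f e * f e) - 2 * q * (\<Sum>e\<in>?A. w e * f e) + q * q * (\<Sum>e\<in>?A. w e * w e)"
    by (simp add: sum_distrib_left sum.distrib[symmetric] sum_subtractf[symmetric]
        power2_eq_square algebra_simps)
  also have "(\<Sum>e\<in>?A. w e * w e) = K"
    using V(2)[of V] unfolding w_def K_def .
  also have "(\<Sum>e\<in>?A. w e * f e) = q * K"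
    using path_flow_potential[OF h, of V] unfolding w_def K_def by simp
  finally have "(\<Sum>e\<in>?A. (f e - q * w e)\<^sup>2) \<le> 0"
    using energy by (simp add: algebra_simps)
  then have "(\<Sum>e\<in>?A. (f e - q * w e)\<^sup>2) = 0"
    by (intro antisym sum_nonneg) auto
  then have "(f e - q * w e)\<^sup>2 = 0"
    using \<open>e \<in> ?A\<close> by (subst (asm) sum_nonneg_eq_0_iff) auto
  then show ?thesis unfolding w_def by simp
qed

text \<open>The cost reads a flow only on the arcs, so agreement there makes the described cost
  unique.\<close>

lemma ue_cost_eq:
  assumes "user_equilibrium G s t q lat f"
    "\<And>f' e. user_equilibrium G s t q lat f' \<Longrightarrow> e \<in> arcs G \<Longrightarrow> f' e = f e"
  shows "ue_cost G s t q lat = flow_cost G lat f"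
  unfolding ue_cost_def
proof (rule the_equality)
  show "\<exists>f'. user_equilibrium G s t q lat f' \<and> flow_cost G lat f = flow_cost G lat f'"
    using assms(1) by blast
next
  fix C assume "\<exists>f'. user_equilibrium G s t q lat f' \<and> C = flow_cost G lat f'"
  then show "C = flow_cost G lat f"
    using assms(2) unfolding flow_cost_def by (auto intro!: sum.cong)
qed

text \<open>If \<open>S < P\<close>, multiply by \<open>S\<close> and expand the square of
  \<open>S - sqrt k * (P - S)\<close>; the bound on \<open>P\<^sup>2\<close> then brings in
  \<open>F\<close>. If \<open>P \<le> S\<close>, the left side is at most 0.\<close>

lemma braess_inequality:
  fixes S P F B k :: real
  assumes "0 < S" "0 \<le> B" "0 < k" "P\<^sup>2 \<le> F * S" "S < P \<Longrightarrow> k * (F - P) \<le> B"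
  shows "(k + 2 * sqrt k) * (P - S) \<le> S + B"
proof (cases "S < P")
  case True
  define y where "y = P - S"
  define r where "r = sqrt k"
  have k: "k = r\<^sup>2" "0 < r" using assms(3) by (simp_all add: r_def)
  have "0 \<le> (S - r * y)\<^sup>2" by simp
  then have "(k + 2 * r) * y * S \<le> S\<^sup>2 + k * (P\<^sup>2 - P * S)"
    unfolding k(1) by (simp add: y_def power2_eq_square algebra_simps)
  also have "\<dots> \<le> S\<^sup>2 + k * (F * S - P * S)"
    using assms(3,4) by simp
  also have "\<dots> = (S + k * (F - P)) * S"
    by (simp add: power2_eq_square algebra_simps)
  also have "\<dots> \<le> (S + B) * S"
    using assms(1) assms(5)[OF True] by (intro mult_right_mono) auto
  finally show ?thesis
    using assms(1) unfolding y_def r_def by simp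
next
  case False
  then have "(k + 2 * sqrt k) * (P - S) \<le> 0"
    using assms(3) by (intro mult_nonneg_nonpos) auto
  with assms(1,2) show ?thesis by linarith
qed

section \<open>The grid with the chord added\<close>

lemma add_arc_grid_simps:
  assumes "is_chord m n ch"
  shows "verts (pre_digraph.add_arc (grid m n) ch) = verts (grid m n)"
    "arcs (pre_digraph.add_arc (grid m n) ch) = insert ch (arcs (grid m n))"
    "tail (pre_digraph.add_arc (grid m n) ch) = fst"
    "head (pre_digraph.add_arc (grid m n) ch) = snd"
    "ch \<notin> arcs (grid m n)"
  using assms by (auto simp: pre_digraph.add_arc_def is_chord_def)

lemma fin_digraph_add_arc_grid:
  assumes "is_chord m n ch"
  shows "fin_digraph (pre_digraph.add_arc (grid m n) ch)"
proof -
  interpret fin_digraph "grid m n" by (rule fin_digraph_grid)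
  show ?thesis
    using assms tail_in_verts head_in_verts
    by unfold_locales (auto simp: add_arc_grid_simps[OF assms] is_chord_def)
qed

lemma apath_add_arc_grid:
  assumes "is_chord m n ch" "pre_digraph.apath (grid m n) u p v"
  shows "pre_digraph.apath (pre_digraph.add_arc (grid m n) ch) u p v"
proof -
  have "pre_digraph.cas (pre_digraph.add_arc (grid m n) ch) u p v = pre_digraph.cas (grid m n) u p v"
    by (induction p arbitrary: u)
      (simp_all add: pre_digraph.cas.simps add_arc_grid_simps[OF assms(1)])
  moreover have "pre_digraph.awalk_verts (pre_digraph.add_arc (grid m n) ch) u p
      = pre_digraph.awalk_verts (grid m n) u p"
    by (induction p arbitrary: u)
      (simp_all add: pre_digraph.awalk_verts.simps add_arc_grid_simps[OF assms(1)])
  ultimately show ?thesis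
    using assms(2)
    by (auto simp: pre_digraph.apath_def pre_digraph.awalk_def add_arc_grid_simps[OF assms(1)])
qed

lemma braess_ratio_le:
  assumes "0 < n" "n \<le> m" "0 < q" "0 < a" "0 \<le> b" "0 \<le> c" "0 \<le> d" and ch: "is_chord m n ch"
  defines "k \<equiv> real (m + n) / real m"
  shows "braess_ratio m n q a b c d ch \<le> 1 + 1 / (k + 2 * sqrt k)"
proof -
  let ?G = "grid m n" and ?s = "(0::nat, 0::nat)" and ?t = "(m, n)"
  define H where "H = pre_digraph.add_arc ?G ch"
  let ?A = "arcs ?G"
  interpret G: fin_digraph ?G by (rule fin_digraph_grid)
  interpret H: fin_digraph H unfolding H_def by (rule fin_digraph_add_arc_grid[OF ch])
  note H_simps = add_arc_grid_simps[OF ch, folded H_def]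
  define lev where "lev x = real (fst x + snd x)" for x :: vertex
  define latH where "latH = (\<lambda>e x. if e = ch then c * x + d else a * x + b)"
  define \<alpha> where "\<alpha> e = (if e = ch then c else a)" for e
  define \<beta> where "\<beta> e = (if e = ch then d else b)" for e
  have latH: "latH = (\<lambda>e x. \<alpha> e * x + \<beta> e)"
    by (auto simp: latH_def \<alpha>_def \<beta>_def fun_eq_iff)
  have st: "?s \<noteq> ?t" and m: "0 < m" using assms(1,2) by auto
  have sumH: "(\<Sum>e\<in>arcs H. g e) = g ch + (\<Sum>e\<in>?A. g e)" for g :: "arc \<Rightarrow> real"
    using H_simps by simp
  obtain V :: "vertex \<Rightarrow> real" where V: "\<And>e. e \<in> ?A \<Longrightarrow> V (fst e) \<le> V (snd e)"
    "\<And>\<phi> :: vertex \<Rightarrow> real.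
       (\<Sum>e\<in>?A. (V (snd e) - V (fst e)) * (\<phi> (snd e) - \<phi> (fst e))) = \<phi> ?t - \<phi> ?s"
    by (rule grid_electrical_potential[of m n]) blast
  define w where "w e = V (snd e) - V (fst e)" for e
  define K where "K = V ?t - V ?s"
  define u where "u = fst ch"
  define v where "v = snd ch"
  have uv: "u \<in> verts ?G" "v \<in> verts ?G" "u \<noteq> v"
    using ch by (auto simp: is_chord_def u_def v_def)

  \<comment> \<open>The old equilibrium\<close>
  obtain p0 where p0: "G.apath ?s p0 ?t"
    using grid_apath_exists[of "(m, n)" m n] by (auto simp: grid_def)
  obtain f0 where f0: "user_equilibrium ?G ?s ?t q (\<lambda>e x. a * x + b) f0"
    using G.user_equilibrium_exists[OF st less_imp_le[OF \<open>0 < q\<close>] p0, of "\<lambda>_. a" "\<lambda>_. b"]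
    by blast
  have old_eq: "f' e = q * w e"
    if "user_equilibrium ?G ?s ?t q (\<lambda>e x. a * x + b) f'" "e \<in> ?A" for f' e
    unfolding w_def by (rule grid_user_equilibrium[OF V that(1) \<open>0 < q\<close> \<open>0 < a\<close> m that(2)])
  have C_old_eq: "ue_cost ?G ?s ?t q (\<lambda>e x. a * x + b) = flow_cost ?G (\<lambda>e x. a * x + b) f0"
  proof (rule ue_cost_eq[OF f0])
    fix f' e assume "user_equilibrium ?G ?s ?t q (\<lambda>e x. a * x + b) f'" "e \<in> ?A"
    from old_eq[OF this] old_eq[OF f0 this(2)] show "f' e = f0 e" by simp
  qed
  obtain h0 where h0: "path_flow ?G ?s ?t q h0 f0"
    using G.user_equilibrium_imp_path_flow[OF f0 st] by blast

  \<comment> \<open>Existence and uniqueness of the new equilibrium\<close>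
  have p0H: "H.apath ?s p0 ?t"
    unfolding H_def by (rule apath_add_arc_grid[OF ch p0])
  have "\<exists>f. user_equilibrium H ?s ?t q latH f"
    unfolding latH
    by (rule H.user_equilibrium_exists[OF st less_imp_le[OF \<open>0 < q\<close>] p0H, of \<alpha> \<beta>])
  then obtain f where f: "user_equilibrium H ?s ?t q latH f" ..
  obtain h where h: "path_flow H ?s ?t q h f"
    using H.user_equilibrium_imp_path_flow[OF f st] by blast
  have pot: "(\<phi> v - \<phi> u) * f' ch + (\<Sum>e\<in>?A. (\<phi> (snd e) - \<phi> (fst e)) * f' e) = q * (\<phi> ?t - \<phi> ?s)"
    if "path_flow H ?s ?t q h' f'" for h' f' and \<phi> :: "vertex \<Rightarrow> real"
    using H.path_flow_potential[OF that, of \<phi>] unfolding sumH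
    by (simp add: H_simps u_def v_def)
  have new_eq: "f' e = f e" if f': "user_equilibrium H ?s ?t q latH f'" and e: "e \<in> arcs H" for f' e
  proof -
    have \<alpha>: "0 \<le> \<alpha> x" for x using assms by (simp add: \<alpha>_def)
    have grid_eq: "f' x = f x" if "x \<in> ?A" for x
    proof (rule H.user_equilibrium_unique[OF f'[unfolded latH] f[unfolded latH] st \<open>0 < q\<close>])
      show "x \<in> arcs H" "0 < \<alpha> x"
        using that H_simps \<open>0 < a\<close> by (auto simp: \<alpha>_def)
    qed (rule \<alpha>)
    show ?thesis
    proof (cases "e = ch")
      case True
      obtain h' where h': "path_flow H ?s ?t q h' f'"
        using H.user_equilibrium_imp_path_flow[OF f' st] by blast
      \<comment> \<open>For \<open>c = 0\<close> the chord has slope zero and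
        \<open>user_equilibrium_unique\<close> does not reach it. Conservation at its head
        \<open>v\<close> recovers its flow from the grid arcs.\<close>
      define \<phi> :: "vertex \<Rightarrow> real" where "\<phi> = (\<lambda>y. if y = v then 1 else 0)"
      have "(\<Sum>e\<in>?A. (\<phi> (snd e) - \<phi> (fst e)) * f' e) = (\<Sum>e\<in>?A. (\<phi> (snd e) - \<phi> (fst e)) * f e)"
        by (intro sum.cong refl) (simp only: grid_eq)
      with pot[OF h, of \<phi>] pot[OF h', of \<phi>] have "(\<phi> v - \<phi> u) * f' ch = (\<phi> v - \<phi> u) * f ch"
        by linarith
      then show ?thesis using uv(3) True by (simp add: \<phi>_def)
    next
      case False
      then show ?thesis using e grid_eq H_simps by auto
    qed
  qed
  have C_new_eq: "ue_cost H ?s ?t q latH = flow_cost H latH f"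
  proof (rule ue_cost_eq[OF f])
    fix f' e assume "user_equilibrium H ?s ?t q latH f'" "e \<in> arcs H"
    then show "f' e = f e" by (rule new_eq)
  qed

  \<comment> \<open>Energies and costs of the two equilibria\<close>
  define x where "x = f ch"
  \<comment> \<open>The chord may close cycles with grid arcs; the bound by \<open>q\<close> holds
    because equilibrium flow is carried by simple paths.\<close>
  have x: "0 \<le> x" "x \<le> q"
    using H.path_flow_bounds[OF h, of ch] H_simps unfolding x_def by auto
  define N where "N = real (m + n)"
  have lev_arc: "lev (snd e) - lev (fst e) = 1" if "e \<in> ?A" for e
    using grid_rank[OF that] unfolding lev_def by simp
  have lev_st: "lev ?t - lev ?s = N" by (simp add: lev_def N_def)
  define F where "F = (\<Sum>e\<in>?A. (f e)\<^sup>2)"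
  define W where "W = (\<Sum>e\<in>?A. w e * f e)"
  have sum_w: "(\<Sum>e\<in>?A. w e) = N"
    using V(2)[of lev] lev_st unfolding w_def[symmetric] by (simp add: lev_arc)
  have sum_ww: "(\<Sum>e\<in>?A. (w e)\<^sup>2) = K"
    using V(2)[of V] unfolding w_def K_def power2_eq_square .
  \<comment> \<open>Hence \<open>W\<close> exceeds \<open>q * K\<close> only if the chord carries
    flow from higher to lower potential.\<close>
  have W: "W = q * K - x * (V v - V u)"
    using pot[OF h, of V] unfolding W_def w_def K_def x_def by (simp add: algebra_simps)
  have sum_f: "(\<Sum>e\<in>?A. f e) = q * N - x * (lev v - lev u)"
    using pot[OF h, of lev] unfolding lev_st x_def by (simp add: lev_arc algebra_simps)
  have N: "0 < N" using m by (simp add: N_def)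
  have K: "0 < K"
  proof (rule ccontr)
    assume "\<not> 0 < K"
    then have "(\<Sum>e\<in>?A. (w e)\<^sup>2) = 0"
      unfolding sum_ww[symmetric] by (intro antisym sum_nonneg) auto
    then have "\<forall>e\<in>?A. w e = 0" by (subst (asm) sum_nonneg_eq_0_iff) auto
    with sum_w N show False by simp
  qed
  have C_old: "flow_cost ?G (\<lambda>e x. a * x + b) f0 = a * (q\<^sup>2 * K) + b * N * q"
  proof -
    have "flow_cost ?G (\<lambda>e x. a * x + b) f0 = (\<Sum>e\<in>?A. q * w e * (a * (q * w e) + b))"
      unfolding flow_cost_def by (intro sum.cong) (auto simp: old_eq[OF f0])
    also have "\<dots> = a * (q\<^sup>2 * (\<Sum>e\<in>?A. (w e)\<^sup>2)) + b * q * (\<Sum>e\<in>?A. w e)"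
      by (simp add: sum_distrib_left sum.distrib[symmetric] power2_eq_square algebra_simps)
    finally show ?thesis by (simp add: sum_ww sum_w mult_ac)
  qed
  \<comment> \<open>\<open>f0\<close> is tested through grid paths, which remain paths in
    \<open>H\<close>; its arbitrary value on the chord does not enter.\<close>
  have C_new_le: "flow_cost H latH f \<le> a * (q * W) + b * N * q"
  proof -
    obtain \<mu> where \<mu>: "flow_cost H latH f = q * \<mu>"
      "\<And>p. H.apath ?s p ?t \<Longrightarrow> \<mu> \<le> path_latency latH f p"
      using H.user_equilibrium_latency[OF f st \<open>0 < q\<close>] by blast
    have "q * \<mu> \<le> (\<Sum>e\<in>?A. latH e (f e) * f0 e)"
    proof (rule G.path_flow_pairing_ge[OF h0])
      fix p assume "G.apath ?s p ?t"
      then have "H.apath ?s p ?t" unfolding H_def by (rule apath_add_arc_grid[OF ch])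
      from \<mu>(2)[OF this] show "\<mu> \<le> (\<Sum>e\<leftarrow>p. latH e (f e))" unfolding path_latency_def .
    qed
    also have "\<dots> = (\<Sum>e\<in>?A. (a * f e + b) * (q * w e))"
      using H_simps by (intro sum.cong) (auto simp: latH_def old_eq[OF f0])
    also have "\<dots> = a * (q * W) + b * q * (\<Sum>e\<in>?A. w e)"
      unfolding W_def by (simp add: sum_distrib_left sum.distrib[symmetric] algebra_simps)
    finally show ?thesis using \<mu>(1) sum_w by (simp add: mult_ac)
  qed
  \<comment> \<open>The chord's own cost is nonnegative and is dropped.\<close>
  have C_new_ge: "a * F + b * (q * N - x * (lev v - lev u)) \<le> flow_cost H latH f"
  proof -
    have "flow_cost H latH f = x * (c * x + d) + (\<Sum>e\<in>?A. f e * (a * f e + b))"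
      unfolding flow_cost_def sumH x_def using H_simps by (auto simp: latH_def intro!: sum.cong)
    also have "(\<Sum>e\<in>?A. f e * (a * f e + b)) = a * F + b * (\<Sum>e\<in>?A. f e)"
      unfolding F_def by (simp add: sum_distrib_left sum.distrib[symmetric] power2_eq_square algebra_simps)
    finally show ?thesis
      using sum_f x(1) assms(6,7) by simp
  qed
  have "W\<^sup>2 \<le> F * K"
    unfolding W_def F_def sum_ww[symmetric]
    using Cauchy_Schwarz_ineq_sum[of w f ?A] by (simp add: mult.commute)
  then have CS: "(a * (q * W))\<^sup>2 \<le> (a * F) * (a * (q\<^sup>2 * K))"
    using mult_left_mono[of "W\<^sup>2" "F * K" "(a * q)\<^sup>2", OF _ zero_le_power2]
    by (simp add: power_mult_distrib power2_eq_square mult_ac)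

  \<comment> \<open>The level gain of a paradoxical chord\<close>
  have V_mono: "V (i, j) \<le> V (i', j')" if "i \<le> i'" "j \<le> j'" "i' \<le> m" "j' \<le> n" for i j i' j'
  proof -
    have "V (i, j) \<le> V (i', j)"
      using that(1,3)
    proof (induction i' rule: dec_induct)
      case (step l)
      then show ?case using V(1)[OF grid_arc_right[of l m j n]] that by simp
    qed simp
    also have "\<dots> \<le> V (i', j')"
      using that(2,4)
    proof (induction j' rule: dec_induct)
      case (step l)
      then show ?case using V(1)[OF grid_arc_up[of i' m l n]] that by simp
    qed simp
    finally show ?thesis .
  qed
  have short: "lev v - lev u \<le> real m" if "q * K < W"
  proof (rule ccontr)
    assume long: "\<not> ?thesis"
    obtain i j where u: "u = (i, j)" by (cases u)
    obtain i' j' where v: "v = (i', j')" by (cases v)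
    have "i' \<le> m" "j' \<le> n" using uv(2) v by (auto simp: grid_def)
    \<comment> \<open>If one coordinate decreased, the other would have to grow by more than
      \<open>m\<close>, which the grid does not allow as \<open>n \<le> m\<close>.\<close>
    moreover from this long have "i \<le> i'" "j \<le> j'"
      using \<open>n \<le> m\<close> by (simp_all add: lev_def u v)
    ultimately have "V u \<le> V v" unfolding u v by (intro V_mono)
    then have "0 \<le> x * (V v - V u)" using x(1) by simp
    with that show False unfolding W by simp
  qed

  \<comment> \<open>Combining the estimates\<close>
  have k: "0 < k" "k * real m = N"
    using m N by (simp_all add: k_def N_def)
  have "(k + 2 * sqrt k) * (a * (q * W) - a * (q\<^sup>2 * K)) \<le> a * (q\<^sup>2 * K) + b * N * q"
  proof (rule braess_inequality[OF _ _ k(1) CS])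
    show "0 < a * (q\<^sup>2 * K)" "0 \<le> b * N * q"
      using assms(3-5) K N by simp_all
    assume "a * (q\<^sup>2 * K) < a * (q * W)"
    then have "q * K < W"
      using assms(3,4) by (simp add: power2_eq_square)
    \<comment> \<open>The constant part of the latencies saved by the chord is at most
      \<open>b * q * m\<close>, the fraction \<open>1 / k\<close> of
      \<open>b * N * q\<close>.\<close>
    then have "x * (lev v - lev u) \<le> x * real m"
      using short x(1) by (intro mult_left_mono)
    also have "\<dots> \<le> q * real m" using x(2) by (intro mult_right_mono) auto
    finally have "b * (x * (lev v - lev u)) \<le> b * (q * real m)"
      using assms(5) by (intro mult_left_mono)
    moreover have "a * F - a * (q * W) \<le> b * (x * (lev v - lev u))"
      using C_new_le C_new_ge by (simp add: algebra_simps)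
    ultimately have "k * (a * F - a * (q * W)) \<le> k * (b * (q * real m))"
      using k(1) by (intro mult_left_mono) auto
    also have "\<dots> = b * N * q" unfolding k(2)[symmetric] by simp
    finally show "k * (a * F - a * (q * W)) \<le> b * N * q" .
  qed
  moreover have pos: "0 < k + 2 * sqrt k" "0 < a * (q\<^sup>2 * K) + b * N * q"
    using k(1) assms(3-5) K N by (auto intro!: add_pos_nonneg)
  ultimately have "a * (q * W) - a * (q\<^sup>2 * K) \<le> (a * (q\<^sup>2 * K) + b * N * q) / (k + 2 * sqrt k)"
    by (simp add: pos_le_divide_eq mult.commute)
  with C_new_le have "flow_cost H latH f \<le> (1 + 1 / (k + 2 * sqrt k)) * (a * (q\<^sup>2 * K) + b * N * q)"
    by (simp add: algebra_simps add_divide_distrib)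
  then show ?thesis
    unfolding braess_ratio_def H_def[symmetric] latH_def[symmetric] C_old_eq C_new_eq C_old
    using pos(2) by (simp add: pos_divide_le_eq)
qed

lemma braess_sup_le:
  assumes "0 < n" "n \<le> m"
  defines "k \<equiv> real (m + n) / real m"
  shows "braess_sup m n \<le> ereal (1 + 1 / (k + 2 * sqrt k))"
  unfolding braess_sup_def
  by (rule Sup_least) (use braess_ratio_le[OF assms(1,2)] in \<open>auto simp: k_def\<close>)

theorem corollary4p2:
  shows "\<exists>g :: real \<Rightarrow> real. g \<in> O[at_right 0](\<lambda>r. r ^ 3) \<and>
    (\<forall>r \<in> \<rat>. 0 < r \<and> r \<le> 1 \<longrightarrow>
       Limsup (inf sequentially (principal {m. r * real m \<in> \<int>}))
         (\<lambda>m. braess_sup m (nat \<lfloor>r * real m\<rfloor>))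
       \<le> ereal (4 / 3 - 2 / 9 * r + 19 / 108 * r ^ 2 + g r))"
proof -
  \<comment> \<open>\<open>g\<close> is the exact remainder of the second-order Taylor polynomial,
    so the asserted right-hand side equals the bound for \<open>k = 1 + r\<close>.\<close>
  define g :: "real \<Rightarrow> real" where "g r = 1 + 1 / (1 + r + 2 * sqrt (1 + r))
      - (4 / 3 - 2 / 9 * r + 19 / 108 * r ^ 2)" for r
  have "g \<in> O[at_right 0](\<lambda>r. r ^ 3)"
    unfolding g_def by real_asymp
  moreover have "Limsup (inf sequentially (principal {m. r * real m \<in> \<int>}))
         (\<lambda>m. braess_sup m (nat \<lfloor>r * real m\<rfloor>))
       \<le> ereal (4 / 3 - 2 / 9 * r + 19 / 108 * r ^ 2 + g r)" if r: "0 < r" "r \<le> 1" for r :: real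
  proof (rule Limsup_bounded)
    show "\<forall>\<^sub>F m in inf sequentially (principal {m. r * real m \<in> \<int>}).
        braess_sup m (nat \<lfloor>r * real m\<rfloor>) \<le> ereal (4 / 3 - 2 / 9 * r + 19 / 108 * r ^ 2 + g r)"
      unfolding eventually_inf_principal
    proof (rule eventually_mono[OF eventually_gt_at_top[of 0]], intro impI)
      fix m :: nat assume m: "0 < m" "m \<in> {m. r * real m \<in> \<int>}"
      define n where "n = nat \<lfloor>r * real m\<rfloor>"
      have rm: "0 < r * real m" "r * real m \<le> real m" using r m(1) by (simp_all add: mult_left_le_one_le)
      have n: "real n = r * real m"
        using m(2) rm(1) unfolding n_def by (auto elim!: Ints_cases)
      then have "0 < n" "n \<le> m" using rm by (metis of_nat_0_less_iff, metis of_nat_le_iff)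
      \<comment> \<open>Here \<open>k\<close> equals \<open>1 + r\<close> exactly, so the bound
        holds for each such \<open>m\<close> and not only in the limit.\<close>
      from braess_sup_le[OF this]
      have "braess_sup m n \<le> ereal (1 + 1 / (1 + r + 2 * sqrt (1 + r)))"
        using m(1) n by (simp add: add_divide_distrib)
      then show "braess_sup m (nat \<lfloor>r * real m\<rfloor>)
          \<le> ereal (4 / 3 - 2 / 9 * r + 19 / 108 * r ^ 2 + g r)"
        unfolding n_def g_def by simp
    qed
  qed
  ultimately show ?thesis by blast
qed

end
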